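(* Let $q\ge 2$ be an integer and $\alpha\in(0,1)$. Let $\gamma(y)=\sum_{n\ge0}g(0,n)y^n$, where $g(0,n)$ is the probability that the simple random walk with laziness $\alpha$ on the infinite $(q+1)$-regular tree returns to its starting vertex after $n$ steps. Let $\rho = \frac{q+1}{\alpha(q+1) + (1-\alpha) 2\sqrt{q}}$. Then, as $n\to\infty$, \[ [y^n] \gamma(y) = \frac{1}{\sqrt{4\pi}} \left( \tfrac{\alpha}{1-\alpha} (q+1) + 2\sqrt{q} \right)^{3/2} \cdot \frac{(q+1)q^{1/4}}{(q-1)^2} \cdot \rho^{-n} n^{-3/2} + O\!\left(\rho^{-n} n^{-2}\right). \]
   Context: Laziness $\alpha$: at each step the walk stays put with probability $\alpha$ and moves to each of the $q+1$ neighbors with probability $\frac{1-\alpha}{q+1}$. *)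

theory Defs
  imports
    "HOL-Probability.Probability"
    "HOL-Computational_Algebra.Formal_Power_Series"
    "HOL-Library.Landau_Symbols"
begin

definition simple_graph :: "'v set \<Rightarrow> 'v set set \<Rightarrow> bool" where
  "simple_graph V E \<longleftrightarrow> (\<forall>e\<in>E. \<exists>u\<in>V. \<exists>v\<in>V. u \<noteq> v \<and> e = {u, v})"

definition adjacent :: "'v set set \<Rightarrow> 'v \<Rightarrow> 'v \<Rightarrow> bool" where
  "adjacent E u v \<longleftrightarrow> {u, v} \<in> E"

definition neighbors :: "'v set set \<Rightarrow> 'v \<Rightarrow> 'v set" where
  "neighbors E v = {u. adjacent E v u}"

definition connected_graph :: "'v set \<Rightarrow> 'v set set \<Rightarrow> bool" where
  "connected_graph V E \<longleftrightarrow> V \<noteq> {} \<and> (\<forall>u\<in>V. \<forall>v\<in>V. (adjacent E)\<^sup>*\<^sup>* u v)"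

text \<open>A cycle is given by the list of its pairwise distinct vertices; the closing edge
  joins the last vertex to the first.\<close>

definition is_cycle :: "'v set set \<Rightarrow> 'v list \<Rightarrow> bool" where
  "is_cycle E c \<longleftrightarrow> 3 \<le> length c \<and> distinct c \<and>
     successively (adjacent E) c \<and> adjacent E (last c) (hd c)"

definition tree_graph :: "'v set \<Rightarrow> 'v set set \<Rightarrow> bool" where
  "tree_graph V E \<longleftrightarrow> simple_graph V E \<and> connected_graph V E \<and> (\<nexists>c. is_cycle E c)"

text \<open>For \<open>d > 0\<close> the cardinality condition forces the neighborhoods to be finite.
  For \<open>d \<ge> 2\<close> a \<open>d\<close>-regular tree is automatically infinite,
  and it is unique up to isomorphism.\<close>

definition regular_tree :: "nat \<Rightarrow> 'v set \<Rightarrow> 'v set set \<Rightarrow> bool" where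
  "regular_tree d V E \<longleftrightarrow> tree_graph V E \<and> (\<forall>v\<in>V. card (neighbors E v) = d)"

definition lazy_step :: "'v set set \<Rightarrow> real \<Rightarrow> 'v \<Rightarrow> 'v pmf" where
  "lazy_step E \<alpha> v =
     bind_pmf (bernoulli_pmf \<alpha>)
       (\<lambda>stay. if stay then return_pmf v else pmf_of_set (neighbors E v))"

text \<open>The distribution of the position after the given number of steps.\<close>

primrec lazy_walk :: "'v set set \<Rightarrow> real \<Rightarrow> 'v \<Rightarrow> nat \<Rightarrow> 'v pmf" where
  "lazy_walk E \<alpha> x 0 = return_pmf x"
| "lazy_walk E \<alpha> x (Suc n) = bind_pmf (lazy_walk E \<alpha> x n) (lazy_step E \<alpha>)"

definition return_prob :: "'v set set \<Rightarrow> real \<Rightarrow> 'v \<Rightarrow> nat \<Rightarrow> real" where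
  "return_prob E \<alpha> x n = pmf (lazy_walk E \<alpha> x n) x"

definition return_gf :: "'v set set \<Rightarrow> real \<Rightarrow> 'v \<Rightarrow> real fps" where
  "return_gf E \<alpha> x = Abs_fps (return_prob E \<alpha> x)"

end

theory Submission
  imports Defs "HOL-Real_Asymp.Real_Asymp"
begin

text \<open>
  Spectral proof. If \<open>d\<close> is the distance from the root and \<open>\<psi> k \<theta>\<close> is the spherical function with
  eigenvalue \<open>2 sqrt q cos \<theta>\<close>, multiplied by \<open>(sin \<theta>)\<^sup>2\<close>, then the expectation of \<open>\<psi> (d X\<^sub>n) \<theta>\<close> is
  \<open>(\<lambda> \<theta>) ^ n * (sin \<theta>)\<^sup>2\<close>, where \<open>\<lambda> \<theta> = \<alpha> + (1 - \<alpha>) 2 sqrt q cos \<theta> / (q + 1)\<close>. Integrating over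
  \<open>\<theta> \<in> [0, \<pi>]\<close> against the weight \<open>2 q (q + 1) / (\<pi> (q\<^sup>2 + 1 - 2 q cos 2\<theta>))\<close> turns \<open>\<psi> k\<close> into the
  indicator of \<open>k = 0\<close>, so the return probability is the corresponding integral of
  \<open>(\<lambda> \<theta>) ^ n * (sin \<theta>)\<^sup>2\<close> (the Kesten-McKay measure). Its asymptotics come from the endpoint \<open>\<theta> = 0\<close>,
  where \<open>\<lambda>\<close> attains its maximum \<open>1 / \<rho>\<close>: a change of variables reduces the leading term to a Beta
  integral. Laziness \<open>\<alpha> > 0\<close> makes the other endpoint exponentially smaller.
\<close>

section \<open>Distances in regular trees\<close>

text \<open>Distinctness is what \<open>is_cycle\<close> asks for. When the new first vertex already
  occurs on the path, the path is cut down to the part that starts there.\<close>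

lemma rtranclp_imp_distinct_path:
  assumes "R\<^sup>*\<^sup>* u w"
  shows "\<exists>p. p \<noteq> [] \<and> hd p = u \<and> last p = w \<and> distinct p \<and> successively R p"
  using assms
proof (induction rule: converse_rtranclp_induct)
  case base
  show ?case by (rule exI[of _ "[w]"]) auto
next
  case (step a b)
  then obtain p where p: "p \<noteq> []" "hd p = b" "last p = w" "distinct p" "successively R p"
    by blast
  show ?case
  proof (cases "a \<in> set p")
    case True
    then obtain xs ys where "p = xs @ a # ys"
      by (auto simp: in_set_conv_decomp)
    with p show ?thesis
      by (intro exI[of _ "a # ys"]) (auto simp: successively_append_iff)
  next
    case False
    with p step.hyps(1) show ?thesis
      by (intro exI[of _ "a # p"]) (auto simp: successively_Cons)
  qed
qed

lemma adjacent_sym: "adjacent E u v \<longleftrightarrow> adjacent E v u"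
  by (simp add: adjacent_def insert_commute)

lemma simple_graph_adjacentD:
  assumes "simple_graph V E" "adjacent E u v"
  shows "u \<in> V" "v \<in> V" "u \<noteq> v"
proof -
  obtain a b where "a \<in> V" "b \<in> V" "a \<noteq> b" "{u, v} = {a, b}"
    using assms unfolding simple_graph_def adjacent_def by metis
  then show "u \<in> V" "v \<in> V" "u \<noteq> v"
    by (auto simp: doubleton_eq_iff)
qed

text \<open>A simple path between two different neighbors that avoids \<open>v\<close> would close
  up through \<open>v\<close> to a cycle.\<close>

lemma tree_neighbors_separated:
  assumes "tree_graph V E" "adjacent E v u" "adjacent E v w"
    and conn: "(\<lambda>a b. adjacent E a b \<and> a \<noteq> v \<and> b \<noteq> v)\<^sup>*\<^sup>* u w"
  shows "u = w"
proof (rule ccontr)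
  assume "u \<noteq> w"
  obtain p where p: "p \<noteq> []" "hd p = u" "last p = w" "distinct p"
      "successively (\<lambda>a b. adjacent E a b \<and> a \<noteq> v \<and> b \<noteq> v) p"
    using rtranclp_imp_distinct_path[OF conn] by blast
  then obtain y ys where p_eq: "p = u # y # ys"
    using \<open>u \<noteq> w\<close> by (cases p; cases "tl p") auto
  \<comment> \<open>The relation only constrains the ends of a step, so a path of one vertex could
    be \<open>v\<close> itself; hence the bound on the length.\<close>
  have avoid: "v \<notin> set xs" if "successively (\<lambda>a b. adjacent E a b \<and> a \<noteq> v \<and> b \<noteq> v) xs" "2 \<le> length xs" for xs
    using that
  proof (induction xs rule: induct_list012)
    case (3 a b zs)
    then show ?case by (cases zs) auto
  qed auto
  have "v \<notin> set p"
    using avoid[OF p(5)] p_eq by simp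
  moreover have "successively (adjacent E) p"
    using p(5) by (rule successively_mono) auto
  ultimately have "is_cycle E (v # p)"
    using p p_eq assms(2,3) by (auto simp: is_cycle_def successively_Cons adjacent_sym)
  with assms(1) show False
    by (auto simp: tree_graph_def)
qed

section \<open>Distance from the root\<close>

definition graph_dist :: "'v set set \<Rightarrow> 'v \<Rightarrow> 'v \<Rightarrow> nat" where
  "graph_dist E x v = (LEAST n. (adjacent E ^^ n) x v)"

lemma graph_dist_relpowp:
  assumes "connected_graph V E" "x \<in> V" "v \<in> V"
  shows "(adjacent E ^^ graph_dist E x v) x v"
proof -
  have "\<exists>n. (adjacent E ^^ n) x v"
    using assms by (auto simp: connected_graph_def rtranclp_power)
  then show ?thesis
    unfolding graph_dist_def by (rule LeastI_ex)
qed

lemma graph_dist_le: "(adjacent E ^^ n) x v \<Longrightarrow> graph_dist E x v \<le> n"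
  unfolding graph_dist_def by (rule Least_le)

lemma graph_dist_self [simp]: "graph_dist E x x = 0"
  using graph_dist_le[of 0 E x x] by simp

lemma graph_dist_eq_0_iff:
  assumes "connected_graph V E" "x \<in> V" "v \<in> V"
  shows "graph_dist E x v = 0 \<longleftrightarrow> v = x"
proof
  assume "graph_dist E x v = 0"
  then show "v = x"
    using graph_dist_relpowp[OF assms] by simp
qed simp

lemma graph_dist_adjacent_le:
  assumes "connected_graph V E" "x \<in> V" "v \<in> V" "adjacent E v u"
  shows "graph_dist E x u \<le> Suc (graph_dist E x v)"
  by (rule graph_dist_le, rule relpowp_Suc_I[OF graph_dist_relpowp[OF assms(1-3)] assms(4)])

lemma graph_dist_predecessor:
  assumes "simple_graph V E" "connected_graph V E" "x \<in> V" "v \<in> V" "graph_dist E x v = Suc k"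
  obtains u where "u \<in> V" "adjacent E v u" "graph_dist E x u = k"
proof -
  obtain u where u: "(adjacent E ^^ k) x u" "adjacent E u v"
    using graph_dist_relpowp[OF assms(2-4)] assms(5) by auto
  have "u \<in> V"
    using simple_graph_adjacentD[OF assms(1) u(2)] by simp
  moreover have "graph_dist E x u = k"
    using graph_dist_le[OF u(1)] graph_dist_adjacent_le[OF assms(2,3) \<open>u \<in> V\<close> u(2)] assms(5) by simp
  ultimately show ?thesis
    using u(2) by (intro that) (auto simp: adjacent_sym)
qed

text \<open>Each move to a predecessor lowers the distance, so every vertex after the first is
  strictly closer to \<open>x\<close> than \<open>v\<close> is. Admitting equal distances for
  \<open>u\<close> later excludes neighbors on the same level.\<close>

lemma geodesic_avoids:
  assumes "simple_graph V E" "connected_graph V E" "x \<in> V" "u \<in> V"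
    and "u \<noteq> v" "v \<noteq> x" "graph_dist E x u \<le> graph_dist E x v"
  shows "(\<lambda>a b. adjacent E a b \<and> a \<noteq> v \<and> b \<noteq> v)\<^sup>*\<^sup>* u x"
  using assms(4,5,7)
proof (induction "graph_dist E x u" arbitrary: u)
  case 0
  then show ?case
    using graph_dist_eq_0_iff[OF assms(2,3), of u] by auto
next
  case (Suc k)
  obtain u' where u': "u' \<in> V" "adjacent E u u'" "graph_dist E x u' = k"
    by (rule graph_dist_predecessor[OF assms(1-3) Suc.prems(1) Suc.hyps(2)[symmetric]])
  have "u' \<noteq> v"
    using Suc u' by auto
  then show ?case
    using Suc u' by (intro converse_rtranclp_into_rtranclp[of _ u u'] Suc.hyps(1)) auto
qed

text \<open>Two neighbors of \<open>v\<close> that are no further from the root than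
  \<open>v\<close> both reach the root without meeting \<open>v\<close>, so they coincide. The bound
  \<open>Suc k\<close> rather than \<open>k\<close> forces all other neighbors one level
  outwards.\<close>

lemma tree_closer_neighbors:
  assumes "tree_graph V E" "x \<in> V" "v \<in> V" "graph_dist E x v = Suc k"
  obtains u where "{w \<in> neighbors E v. graph_dist E x w \<le> Suc k} = {u}" "graph_dist E x u = k"
proof -
  have G: "simple_graph V E" "connected_graph V E"
    using assms(1) by (auto simp: tree_graph_def)
  obtain u where u: "u \<in> V" "adjacent E v u" "graph_dist E x u = k"
    by (rule graph_dist_predecessor[OF G assms(2-4)])
  have "v \<noteq> x"
    using assms(4) by auto
  have uniq: "w = u" if w: "adjacent E v w" "graph_dist E x w \<le> Suc k" for w
  proof -
    let ?R = "\<lambda>a b. adjacent E a b \<and> a \<noteq> v \<and> b \<noteq> v"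
    have "symp ?R"
      by (simp add: symp_def adjacent_sym)
    have to_root: "?R\<^sup>*\<^sup>* y x" if "adjacent E v y" "graph_dist E x y \<le> Suc k" for y
    proof (rule geodesic_avoids[OF G assms(2)])
      show "y \<in> V" "y \<noteq> v"
        using simple_graph_adjacentD[OF G(1) that(1)] by simp_all
    qed (use \<open>v \<noteq> x\<close> that(2) assms(4) in simp_all)
    have "?R\<^sup>*\<^sup>* w x" "?R\<^sup>*\<^sup>* u x"
      using w u by (intro to_root; simp)+
    have "?R\<^sup>*\<^sup>* x u"
      using sympD[OF symp_rtranclp[OF \<open>symp ?R\<close>] \<open>?R\<^sup>*\<^sup>* u x\<close>] .
    with \<open>?R\<^sup>*\<^sup>* w x\<close> have "?R\<^sup>*\<^sup>* w u"
      by (rule rtranclp_trans)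
    then show ?thesis
      by (rule tree_neighbors_separated[OF assms(1) w(1) u(2)])
  qed
  show ?thesis
  proof (rule that[of u])
    show "{w \<in> neighbors E v. graph_dist E x w \<le> Suc k} = {u}"
    proof (intro equalityI subsetI)
      fix w assume "w \<in> {w \<in> neighbors E v. graph_dist E x w \<le> Suc k}"
      then have "w = u"
        by (intro uniq) (simp_all add: neighbors_def)
      then show "w \<in> {u}" by simp
    qed (use u in \<open>simp add: neighbors_def\<close>)
  qed (fact u(3))
qed

section \<open>Neighbor sums of radial functions\<close>

lemma finite_neighbors_regular_tree:
  "regular_tree (Suc q) V E \<Longrightarrow> v \<in> V \<Longrightarrow> finite (neighbors E v)"
  by (rule card_ge_0_finite) (simp add: regular_tree_def)

lemma neighbors_subset: "simple_graph V E \<Longrightarrow> neighbors E v \<subseteq> V"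
  using simple_graph_adjacentD(2) by (fastforce simp: neighbors_def)

lemma sum_neighbors_dist_root:
  fixes h :: "nat \<Rightarrow> real"
  assumes "regular_tree (Suc q) V E" "x \<in> V"
  shows "(\<Sum>u\<in>neighbors E x. h (graph_dist E x u)) = (real q + 1) * h 1"
proof -
  have T: "simple_graph V E" "connected_graph V E" "card (neighbors E x) = Suc q"
    using assms by (auto simp: regular_tree_def tree_graph_def)
  have "graph_dist E x u = 1" if "u \<in> neighbors E x" for u
  proof -
    have "adjacent E x u"
      using that by (simp add: neighbors_def)
    note u = simple_graph_adjacentD[OF T(1) this] graph_dist_adjacent_le[OF T(2) assms(2,2) this]
    have "graph_dist E x u \<noteq> 0"
      using graph_dist_eq_0_iff[OF T(2) assms(2) u(2)] u(3) by simp
    then show ?thesis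
      using u(4) by simp
  qed
  then have "(\<Sum>u\<in>neighbors E x. h (graph_dist E x u)) = (\<Sum>u\<in>neighbors E x. h 1)"
    by (intro sum.cong) auto
  then show ?thesis
    using T(3) by simp
qed

text \<open>One neighbor lies at distance \<open>k\<close> and the other \<open>q\<close> at
  \<open>k + 2\<close>, so the adjacency operator acts on functions of the distance as a three-term
  recurrence.\<close>

lemma sum_neighbors_dist_Suc:
  fixes h :: "nat \<Rightarrow> real"
  assumes "regular_tree (Suc q) V E" "x \<in> V" "v \<in> V" "graph_dist E x v = Suc k"
  shows "(\<Sum>u\<in>neighbors E v. h (graph_dist E x u)) = h k + real q * h (k + 2)"
proof -
  have T: "tree_graph V E" "connected_graph V E" "card (neighbors E v) = Suc q"
    using assms by (auto simp: regular_tree_def tree_graph_def)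
  have fin: "finite (neighbors E v)"
    using finite_neighbors_regular_tree[OF assms(1,3)] .
  obtain u where u: "{w \<in> neighbors E v. graph_dist E x w \<le> Suc k} = {u}" "graph_dist E x u = k"
    by (rule tree_closer_neighbors[OF T(1) assms(2-4)])
  have u_nb: "u \<in> neighbors E v"
    using equalityD2[OF u(1)] by simp
  have "graph_dist E x w = k + 2" if "w \<in> neighbors E v - {u}" for w
  proof -
    have "\<not> graph_dist E x w \<le> Suc k"
      using equalityD1[OF u(1)] that by auto
    moreover have "graph_dist E x w \<le> Suc (Suc k)"
      using graph_dist_adjacent_le[OF T(2) assms(2,3), of w] assms(4) that by (simp add: neighbors_def)
    ultimately show ?thesis by simp
  qed
  then have "(\<Sum>w\<in>neighbors E v - {u}. h (graph_dist E x w)) = (\<Sum>w\<in>neighbors E v - {u}. h (k + 2))"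
    by (intro sum.cong) auto
  then show ?thesis
    using T(3) u(2) fin u_nb by (simp add: sum.remove)
qed

section \<open>The walk and the spherical functions\<close>

lemma set_pmf_lazy_step:
  assumes "finite (neighbors E v)" "neighbors E v \<noteq> {}"
  shows "set_pmf (lazy_step E \<alpha> v) \<subseteq> insert v (neighbors E v)"
  using set_pmf_of_set[OF assms(2,1)] by (auto simp: lazy_step_def split: if_splits)

lemma expectation_lazy_step:
  fixes h :: "'v \<Rightarrow> real"
  assumes "finite (neighbors E v)" "neighbors E v \<noteq> {}" "0 \<le> \<alpha>" "\<alpha> \<le> 1"
  shows "measure_pmf.expectation (lazy_step E \<alpha> v) h =
    \<alpha> * h v + (1 - \<alpha>) * ((\<Sum>u\<in>neighbors E v. h u) / real (card (neighbors E v)))"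
  unfolding lazy_step_def using assms
  by (subst pmf_expectation_bind[of UNIV]) (auto simp: UNIV_bool integral_pmf_of_set)

text \<open>Finite support turns expectations into finite sums, which can later be exchanged with
  the integral over \<theta>.\<close>

lemma lazy_walk_support:
  assumes "regular_tree (Suc q) V E" "x \<in> V"
  shows "finite (set_pmf (lazy_walk E \<alpha> x n)) \<and> set_pmf (lazy_walk E \<alpha> x n) \<subseteq> V"
proof (induction n)
  case 0
  then show ?case using assms(2) by simp
next
  case (Suc n)
  have "simple_graph V E"
    using assms(1) by (auto simp: regular_tree_def tree_graph_def)
  have "finite (set_pmf (lazy_step E \<alpha> v)) \<and> set_pmf (lazy_step E \<alpha> v) \<subseteq> V" if "v \<in> V" for v
  proof -
    have "finite (neighbors E v)"
      using finite_neighbors_regular_tree[OF assms(1) that] .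
    moreover have "neighbors E v \<noteq> {}"
      using assms(1) that by (auto simp: regular_tree_def)
    ultimately show ?thesis
      using set_pmf_lazy_step[of E v \<alpha>] neighbors_subset[OF \<open>simple_graph V E\<close>, of v] that
      by (meson finite_insert finite_subset insert_subsetI subset_trans)
  qed
  with Suc show ?case
    by (auto simp: subset_iff)
qed

text \<open>By \<open>root\<close> and \<open>step\<close>, \<open>h\<close> of the distance is an
  eigenfunction of the adjacency operator with eigenvalue \<open>t\<close>. Each lazy step therefore
  multiplies its expectation by the same factor.\<close>

lemma expectation_lazy_walk_eigenfunction:
  fixes h :: "nat \<Rightarrow> real"
  assumes "regular_tree (Suc q) V E" "x \<in> V" "0 \<le> \<alpha>" "\<alpha> \<le> 1"
    and root: "(real q + 1) * h 1 = t * h 0"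
    and step: "\<And>k. h k + real q * h (k + 2) = t * h (Suc k)"
  shows "measure_pmf.expectation (lazy_walk E \<alpha> x n) (\<lambda>v. h (graph_dist E x v)) =
    (\<alpha> + (1 - \<alpha>) * t / (real q + 1)) ^ n * h 0"
proof (induction n)
  case 0
  then show ?case by simp
next
  case (Suc n)
  let ?W = "lazy_walk E \<alpha> x n" and ?H = "\<lambda>v. h (graph_dist E x v)"
  let ?c = "\<alpha> + (1 - \<alpha>) * t / (real q + 1)"
  have supp: "finite (set_pmf ?W)" "set_pmf ?W \<subseteq> V"
    using lazy_walk_support[OF assms(1,2)] by auto
  have conn: "connected_graph V E"
    using assms(1) by (auto simp: regular_tree_def tree_graph_def)
  have nb: "finite (neighbors E v)" "neighbors E v \<noteq> {}" "card (neighbors E v) = Suc q" if "v \<in> V" for v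
    using finite_neighbors_regular_tree[OF assms(1) that] assms(1) that
    by (auto simp: regular_tree_def)
  have eig: "measure_pmf.expectation (lazy_step E \<alpha> v) ?H = ?c * ?H v" if "v \<in> V" for v
  proof -
    have "(\<Sum>u\<in>neighbors E v. ?H u) = t * ?H v"
    proof (cases "graph_dist E x v")
      case 0
      then have "v = x"
        using graph_dist_eq_0_iff[OF conn assms(2) that] by simp
      then show ?thesis
        using sum_neighbors_dist_root[OF assms(1,2), of h] root by simp
    next
      case (Suc k)
      then show ?thesis
        using sum_neighbors_dist_Suc[OF assms(1,2) that Suc, of h] step[of k] by simp
    qed
    then show ?thesis
      using expectation_lazy_step[OF nb(1,2)[OF that] assms(3,4), of ?H] nb(3)[OF that]
      by (simp add: algebra_simps)
  qed
  have fin: "finite (set_pmf (lazy_step E \<alpha> v))" if "v \<in> set_pmf ?W" for v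
    using set_pmf_lazy_step[of E v \<alpha>] nb[of v] supp that
    by (meson finite_insert finite_subset subsetD)
  have "measure_pmf.expectation (lazy_walk E \<alpha> x (Suc n)) ?H =
      (\<Sum>v\<in>set_pmf ?W. pmf ?W v *\<^sub>R measure_pmf.expectation (lazy_step E \<alpha> v) ?H)"
    using supp fin by (simp add: pmf_expectation_bind)
  also have "\<dots> = (\<Sum>v\<in>set_pmf ?W. ?c * (?H v * pmf ?W v))"
    using eig supp by (intro sum.cong) auto
  also have "\<dots> = ?c * measure_pmf.expectation ?W ?H"
    using supp by (subst integral_measure_pmf[of "set_pmf ?W"]) (auto simp: sum_distrib_left mult_ac)
  finally show ?case
    using Suc by simp
qed

text \<open>Up to the factor \<open>(sin \<theta>)\<^sup>2\<close>, these are the spherical functions of the tree, with eigenvalue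
  \<open>2 sqrt q cos \<theta>\<close>; the factor removes the denominator \<open>sin \<theta>\<close>.\<close>

definition spherical :: "nat \<Rightarrow> nat \<Rightarrow> real \<Rightarrow> real" where
  "spherical q k \<theta> = (1 / sqrt (real q)) ^ k / (2 * (real q + 1)) *
     ((real q + 1) * cos (real k * \<theta>) - real q * cos ((real k + 2) * \<theta>) - cos ((real k - 2) * \<theta>))"

lemma cos_add_cos_shift: "cos (m * \<theta>) + cos ((m + 2) * \<theta>) = 2 * cos \<theta> * cos ((m + 1) * \<theta>)" for m \<theta> :: real
proof -
  have *: "m * \<theta> = (m + 1) * \<theta> - \<theta>" "(m + 2) * \<theta> = (m + 1) * \<theta> + \<theta>"
    by (simp_all add: algebra_simps)
  show ?thesis
    unfolding * cos_add cos_diff by simp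
qed

lemma spherical_0: "spherical q 0 \<theta> = (sin \<theta>)\<^sup>2"
proof -
  have "cos (- 2 * \<theta>) = cos (2 * \<theta>)"
    using cos_minus[of "2 * \<theta>"] by simp
  then have "spherical q 0 \<theta> = (1 - cos (2 * \<theta>)) / 2"
    by (simp add: spherical_def field_simps)
  then show ?thesis
    by (simp add: cos_double_sin)
qed

lemma spherical_root:
  assumes "0 < q"
  shows "(real q + 1) * spherical q 1 \<theta> = 2 * sqrt (real q) * cos \<theta> * spherical q 0 \<theta>"
proof -
  have sq: "sqrt (real q) * sqrt (real q) = real q" "sqrt (real q) > 0"
    using assms by auto
  \<comment> \<open>At index 1 the last cosine of the bracket is \<open>cos (- \<theta>)\<close>; it
    cancels one \<open>cos \<theta>\<close> and leaves a common factor \<open>q\<close>.\<close>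
  have "(real q + 1) * spherical q 1 \<theta> = (real q / sqrt (real q)) * (cos \<theta> - cos (3 * \<theta>)) / 2"
  proof -
    have Q: "c * (a / (2 * c) * b) = a / 2 * b" if "c \<noteq> 0" for a b c :: real
      using that by simp
    have "(real q + 1) * spherical q 1 \<theta> = (1 / sqrt (real q)) / 2 *
        ((real q + 1) * cos \<theta> - real q * cos (3 * \<theta>) - cos (- \<theta>))"
      unfolding spherical_def by (subst Q) (simp_all del: cos_minus)
    then show ?thesis
      by (simp add: algebra_simps diff_divide_distrib)
  qed
  also have "real q / sqrt (real q) = sqrt (real q)"
    using sq by (simp add: field_simps)
  also have "cos \<theta> - cos (3 * \<theta>) = 4 * cos \<theta> * (sin \<theta>)\<^sup>2"
    using cos_add_cos_shift[of 1 \<theta>] cos_double_sin[of \<theta>] by (simp add: right_diff_distrib)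
  finally show ?thesis
    by (simp add: spherical_0)
qed

text \<open>The bracket \<open>A\<close> is a combination of cosines and so satisfies the recurrence
  of \<open>cos (m * \<theta>)\<close> in \<open>m\<close>; the powers of \<open>1 / sqrt q\<close>
  absorb the factor \<open>q\<close>.\<close>

lemma spherical_step:
  assumes "0 < q"
  shows "spherical q k \<theta> + real q * spherical q (k + 2) \<theta> =
    2 * sqrt (real q) * cos \<theta> * spherical q (Suc k) \<theta>"
proof -
  define s where "s = sqrt (real q)"
  have s: "real q = s * s" "s > 0"
    using assms by (auto simp: s_def)
  define A where "A m = (real q + 1) * cos (m * \<theta>) - real q * cos ((m + 2) * \<theta>) - cos ((m - 2) * \<theta>)" for m
  have sph: "spherical q j \<theta> = (1 / s) ^ j / (2 * (real q + 1)) * A (real j)" for j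
    by (simp add: spherical_def A_def s_def)
  have A: "A m + A (m + 2) = 2 * cos \<theta> * A (m + 1)" for m
    using cos_add_cos_shift[of m \<theta>] cos_add_cos_shift[of "m + 2" \<theta>] cos_add_cos_shift[of "m - 2" \<theta>]
    unfolding A_def by (simp add: add.commute) algebra
  have "spherical q k \<theta> + real q * spherical q (k + 2) \<theta> =
      (1 / s) ^ k / (2 * (real q + 1)) * (A (real k) + A (real k + 2))"
  proof -
    have "real q * (1 / s) ^ (k + 2) = (1 / s) ^ k"
      using s(2) by (simp add: s(1) power_add)
    then show ?thesis
      unfolding sph distrib_left
      by (metis (no_types, opaque_lifting) mult.assoc of_nat_add of_nat_numeral times_divide_eq_right)
  qed
  also have "\<dots> = 2 * s * cos \<theta> * ((1 / s) ^ Suc k / (2 * (real q + 1)) * A (real (Suc k)))"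
    using s(2) by (simp add: A add.commute)
  finally show ?thesis
    by (simp add: sph s_def)
qed

section \<open>Spectral integral for the return probability\<close>

text \<open>The right-hand side is the squared distance from \<open>c\<close> to the point of the
  unit circle with angle \<open>2 * \<theta>\<close>.\<close>

lemma poisson_denom_ge: "(c - 1)\<^sup>2 \<le> c\<^sup>2 + 1 - 2 * c * cos (2 * \<theta>)" if "0 \<le> c" for c \<theta> :: real
  using mult_left_mono[OF cos_le_one[of "2 * \<theta>"], of "2 * c"] that
  by (simp add: power2_eq_square algebra_simps)

lemma poisson_denom_pos: "0 < c\<^sup>2 + 1 - 2 * c * cos (2 * \<theta>)" if "1 < c" for c \<theta> :: real
  using poisson_denom_ge[of c \<theta>] that by (smt (verit) zero_less_power2)

text \<open>The integrand contains the Poisson kernel without its factor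
  \<open>c\<^sup>2 - 1\<close>. The real index allows \<open>m - 2\<close> without
  truncation.\<close>

definition poisson_coeff :: "real \<Rightarrow> real \<Rightarrow> real" where
  "poisson_coeff c m = integral {0..pi} (\<lambda>\<theta>. cos (m * \<theta>) / (c\<^sup>2 + 1 - 2 * c * cos (2 * \<theta>)))"

context
  fixes c :: real
  assumes c: "1 < c"
begin

lemma poisson_continuous:
  "continuous_on S (\<lambda>\<theta>. cos (m * \<theta>) / (c\<^sup>2 + 1 - 2 * c * cos (2 * \<theta>)))"
  using poisson_denom_pos[OF c] by (intro continuous_intros) (metis less_irrefl)

lemma poisson_has_integral:
  "((\<lambda>\<theta>. cos (m * \<theta>) / (c\<^sup>2 + 1 - 2 * c * cos (2 * \<theta>))) has_integral poisson_coeff c m) {0..pi}"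
  unfolding poisson_coeff_def
  by (intro integrable_integral integrable_continuous_interval poisson_continuous)

lemma poisson_coeff_bound: "\<bar>poisson_coeff c m\<bar> \<le> pi / (c - 1)\<^sup>2"
proof -
  have "norm (poisson_coeff c m) \<le> 1 / (c - 1)\<^sup>2 * (pi - 0)"
    unfolding poisson_coeff_def
  proof (intro integral_bound poisson_continuous)
    fix \<theta> :: real
    have "\<bar>cos (m * \<theta>)\<bar> / (c\<^sup>2 + 1 - 2 * c * cos (2 * \<theta>)) \<le> 1 / (c - 1)\<^sup>2"
      using poisson_denom_ge[of c \<theta>] c by (intro frac_le) auto
    then show "norm (cos (m * \<theta>) / (c\<^sup>2 + 1 - 2 * c * cos (2 * \<theta>))) \<le> 1 / (c - 1)\<^sup>2"
      using poisson_denom_pos[OF c, of \<theta>] by (simp add: abs_divide)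
  qed simp
  then show ?thesis by simp
qed

lemma poisson_coeff_minus: "poisson_coeff c (- m) = poisson_coeff c m"
  by (simp add: poisson_coeff_def)

lemma has_integral_cos_nat:
  assumes "k > 0"
  shows "((\<lambda>\<theta>. cos (real k * \<theta>)) has_integral 0) {0..pi}"
proof -
  have "((\<lambda>\<theta>. cos (real k * \<theta>)) has_integral (sin (real k * pi) / real k - sin (real k * 0) / real k)) {0..pi}"
    using assms
    by (intro fundamental_theorem_of_calculus)
       (auto intro!: derivative_eq_intros simp flip: has_real_derivative_iff_has_vector_derivative)
  then show ?thesis by simp
qed

text \<open>Multiplying the integrand by the denominator leaves a cosine, and
  \<open>2 * cos (2 * \<theta>) * cos (m * \<theta>)\<close> splits into the two shifted
  cosines.\<close>

lemma poisson_coeff_recurrence: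
  "((\<lambda>\<theta>. cos (m * \<theta>)) has_integral
    ((c\<^sup>2 + 1) * poisson_coeff c m - c * (poisson_coeff c (m + 2) + poisson_coeff c (m - 2)))) {0..pi}"
proof (rule has_integral_eq)
  let ?w = "\<lambda>\<theta>. c\<^sup>2 + 1 - 2 * c * cos (2 * \<theta>)"
  show "((\<lambda>\<theta>. (c\<^sup>2 + 1) * (cos (m * \<theta>) / ?w \<theta>) - c * (cos ((m + 2) * \<theta>) / ?w \<theta> + cos ((m - 2) * \<theta>) / ?w \<theta>))
    has_integral
    ((c\<^sup>2 + 1) * poisson_coeff c m - c * (poisson_coeff c (m + 2) + poisson_coeff c (m - 2)))) {0..pi}"
    by (intro has_integral_diff has_integral_add has_integral_mult_right poisson_has_integral)
  fix \<theta>
  have sum: "cos ((m + 2) * \<theta>) + cos ((m - 2) * \<theta>) = 2 * cos (2 * \<theta>) * cos (m * \<theta>)"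
    by (simp add: distrib_right left_diff_distrib cos_add cos_diff)
  have "(c\<^sup>2 + 1) * (cos (m * \<theta>) / ?w \<theta>) - c * (cos ((m + 2) * \<theta>) / ?w \<theta> + cos ((m - 2) * \<theta>) / ?w \<theta>) =
      ((c\<^sup>2 + 1) * cos (m * \<theta>) - c * (cos ((m + 2) * \<theta>) + cos ((m - 2) * \<theta>))) / ?w \<theta>"
    by (simp add: diff_divide_distrib add_divide_distrib distrib_left)
  also have "\<dots> = cos (m * \<theta>) * ?w \<theta> / ?w \<theta>"
    unfolding sum by (simp add: algebra_simps)
  also have "\<dots> = cos (m * \<theta>)"
    using poisson_denom_pos[OF c, of \<theta>] by simp
  finally show "(c\<^sup>2 + 1) * (cos (m * \<theta>) / ?w \<theta>) - c * (cos ((m + 2) * \<theta>) / ?w \<theta> + cos ((m - 2) * \<theta>) / ?w \<theta>) =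
      cos (m * \<theta>)" .
qed

text \<open>In steps of two the characteristic roots are \<open>c\<close> and \<open>1 / c\<close>;
  boundedness will leave only \<open>1 / c\<close>.\<close>

lemma poisson_coeff_recurrence_pos:
  assumes "k > 0"
  shows "(c\<^sup>2 + 1) * poisson_coeff c (real k) =
    c * (poisson_coeff c (real k + 2) + poisson_coeff c (real k - 2))"
  using has_integral_unique[OF poisson_coeff_recurrence has_integral_cos_nat[OF assms]] by simp

text \<open>The defect \<open>D k\<close> of the claimed relation grows like \<open>c ^ (k div 2)\<close> by the recurrence, unless
  it vanishes; but it is bounded.\<close>

lemma poisson_coeff_add_2: "poisson_coeff c (real k + 2) = poisson_coeff c (real k) / c"
proof -
  define D where "D k = poisson_coeff c (real k + 2) - poisson_coeff c (real k) / c" for k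
  \<comment> \<open>\<open>D\<close> annihilates the solution with ratio \<open>1 / c\<close>, so
    the ratio \<open>c\<close> remains. The recurrence is applied at \<open>k + 2\<close>, which is
    positive even for \<open>k = 0\<close>.\<close>
  have D_step: "D (k + 2) = c * D k" for k
    using poisson_coeff_recurrence_pos[of "k + 2"] c
    by (simp add: D_def field_simps power2_eq_square)
  have D_pow: "D (k + 2 * j) = c ^ j * D k" for k j
  proof (induction j)
    case (Suc j)
    then show ?case
      using D_step[of "k + 2 * j"] by (simp add: add.assoc)
  qed simp
  define M where "M = pi / (c - 1)\<^sup>2"
  have D_bound: "\<bar>D i\<bar> \<le> 2 * M" for i
  proof -
    have "\<bar>poisson_coeff c (real i) / c\<bar> \<le> \<bar>poisson_coeff c (real i)\<bar>"
      using c by (simp add: abs_divide divide_le_eq_1 mult_left_le divide_le_eq mult_le_cancel_left1)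
    then show ?thesis
      using poisson_coeff_bound[of "real i"] poisson_coeff_bound[of "real i + 2"]
      unfolding D_def M_def by linarith
  qed
  have "D k = 0"
  proof (rule ccontr)
    assume "D k \<noteq> 0"
    obtain j where "2 * M / \<bar>D k\<bar> < c ^ j"
      using real_arch_pow[OF c] by blast
    then have "2 * M < \<bar>D (k + 2 * j)\<bar>"
      using \<open>D k \<noteq> 0\<close> c by (simp add: D_pow abs_mult divide_less_eq)
    then show False
      using D_bound[of "k + 2 * j"] by simp
  qed
  then show ?thesis by (simp add: D_def)
qed

text \<open>At \<open>m = 0\<close> evenness makes both shifted coefficients equal to
  \<open>poisson_coeff c 0 / c\<close>, so the recurrence determines the value.\<close>

lemma poisson_coeff_0: "poisson_coeff c 0 = pi / (c\<^sup>2 - 1)"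
proof -
  have "((\<lambda>\<theta>. cos (0 * \<theta>)) has_integral pi) {0..pi}"
    using has_integral_const_real[of "1 :: real" 0 pi] by simp
  then have "(c\<^sup>2 + 1) * poisson_coeff c 0 - c * (poisson_coeff c (0 + 2) + poisson_coeff c (0 - 2)) = pi"
    by (rule has_integral_unique[OF poisson_coeff_recurrence])
  then have "(c\<^sup>2 - 1) * poisson_coeff c 0 = pi"
    using poisson_coeff_minus[of 2] poisson_coeff_add_2[of 0] c by (simp add: algebra_simps)
  moreover have "c\<^sup>2 - 1 \<noteq> 0"
    using one_less_power[OF c, of 2] by simp
  ultimately show ?thesis
    by (simp add: field_simps)
qed

text \<open>Evenness identifies the coefficient at \<open>-1\<close> with the one at
  \<open>1\<close>, so the recurrence becomes a homogeneous equation with nonzero factor.\<close>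

lemma poisson_coeff_1: "poisson_coeff c 1 = 0"
proof -
  have "(c\<^sup>2 - c) * poisson_coeff c 1 = 0"
    using poisson_coeff_recurrence_pos[of 1] poisson_coeff_minus[of 1] poisson_coeff_add_2[of 1] c
    by (simp add: algebra_simps)
  then show ?thesis
    using c by (simp add: power2_eq_square)
qed

text \<open>This is the bracket of \<open>spherical\<close> integrated against the kernel. From
  \<open>k = 2\<close> on, the ratio \<open>1 / c\<close> gives \<open>(c + 1) - 1 - c = 0\<close>.
  At \<open>k = 1\<close> all three coefficients vanish. At \<open>k = 0\<close> evenness breaks the
  geometric pattern, since the coefficient at \<open>-2\<close> equals the one at
  \<open>2\<close>.\<close>

lemma poisson_coeff_combination:
  "(c + 1) * poisson_coeff c (real k) - c * poisson_coeff c (real k + 2) - poisson_coeff c (real k - 2) =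
     (if k = 0 then pi / c else 0)"
proof -
  consider "k = 0" | "k = 1" | j where "k = j + 2"
    by (metis One_nat_def add_2_eq_Suc' not0_implies_Suc)
  then show ?thesis
  proof cases
    case 1
    have "c\<^sup>2 - 1 \<noteq> 0"
      using one_less_power[OF c, of 2] by simp
    have "(c + 1) * poisson_coeff c 0 - c * poisson_coeff c 2 - poisson_coeff c (- 2) =
        (c\<^sup>2 - 1) * poisson_coeff c 0 / c"
      using poisson_coeff_add_2[of 0] poisson_coeff_minus[of 2] c
      by (simp add: field_simps power2_eq_square)
    then show ?thesis
      using 1 \<open>c\<^sup>2 - 1 \<noteq> 0\<close> by (simp add: poisson_coeff_0)
  next
    case 2
    then show ?thesis
      using poisson_coeff_add_2[of 1] poisson_coeff_minus[of 1] by (simp add: poisson_coeff_1)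
  next
    case 3
    then show ?thesis
      using poisson_coeff_add_2[of j] poisson_coeff_add_2[of "j + 2"] c by (simp add: field_simps)
  qed
qed

end

section \<open>The Kesten-McKay measure\<close>

text \<open>The density lacks its usual factor \<open>(sin \<theta>)\<^sup>2\<close> because
  \<open>spherical\<close> carries it. The constant is fixed by \<open>k = 0\<close>, where it has
  to cancel \<open>1 / (2 * (q + 1))\<close> and the value \<open>pi / q\<close> of the
  combination.\<close>

lemma spherical_orthogonality:
  assumes "q \<ge> 2"
  shows "((\<lambda>\<theta>. 2 * real q * (real q + 1) / pi * (spherical q k \<theta> / ((real q)\<^sup>2 + 1 - 2 * real q * cos (2 * \<theta>))))
    has_integral (if k = 0 then 1 else 0)) {0..pi}"
proof -
  have c: "1 < real q"
    using assms by simp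
  define C where "C = 2 * real q * (real q + 1) / pi * ((1 / sqrt (real q)) ^ k / (2 * (real q + 1)))"
  have "((\<lambda>\<theta>. C * ((real q + 1) * (cos (real k * \<theta>) / ((real q)\<^sup>2 + 1 - 2 * real q * cos (2 * \<theta>)))
      - real q * (cos ((real k + 2) * \<theta>) / ((real q)\<^sup>2 + 1 - 2 * real q * cos (2 * \<theta>)))
      - cos ((real k - 2) * \<theta>) / ((real q)\<^sup>2 + 1 - 2 * real q * cos (2 * \<theta>)))) has_integral
    C * ((real q + 1) * poisson_coeff q (real k) - real q * poisson_coeff q (real k + 2) -
      poisson_coeff q (real k - 2))) {0..pi}"
    by (intro has_integral_diff has_integral_mult_right poisson_has_integral c)
  also have "(\<lambda>\<theta>. C * ((real q + 1) * (cos (real k * \<theta>) / ((real q)\<^sup>2 + 1 - 2 * real q * cos (2 * \<theta>)))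
      - real q * (cos ((real k + 2) * \<theta>) / ((real q)\<^sup>2 + 1 - 2 * real q * cos (2 * \<theta>)))
      - cos ((real k - 2) * \<theta>) / ((real q)\<^sup>2 + 1 - 2 * real q * cos (2 * \<theta>)))) =
    (\<lambda>\<theta>. 2 * real q * (real q + 1) / pi * (spherical q k \<theta> / ((real q)\<^sup>2 + 1 - 2 * real q * cos (2 * \<theta>))))"
  proof -
    have "C * ((real q + 1) * (a / w) - real q * (b / w) - d / w) =
        2 * real q * (real q + 1) / pi * ((1 / sqrt (real q)) ^ k / (2 * (real q + 1)) *
          ((real q + 1) * a - real q * b - d) / w)" for a b d w
    proof -
      have "(real q + 1) * (a / w) - real q * (b / w) - d / w = ((real q + 1) * a - real q * b - d) / w"
        by (simp add: diff_divide_distrib)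
      then show ?thesis
        unfolding C_def by simp
    qed
    then show ?thesis
      unfolding spherical_def by (intro ext)
  qed
  also have "C * ((real q + 1) * poisson_coeff q (real k) - real q * poisson_coeff q (real k + 2) -
      poisson_coeff q (real k - 2)) = (if k = 0 then 1 else 0)"
    using c unfolding poisson_coeff_combination[OF c] C_def by simp
  finally show ?thesis .
qed

text \<open>The expectation of \<open>spherical\<close> at the distance is known from the
  eigenvalue; integrating it over \<theta> keeps only the vertices at distance 0, that is
  \<open>x\<close>.\<close>

lemma return_prob_integral:
  assumes "q \<ge> 2" "regular_tree (Suc q) V E" "x \<in> V" "0 \<le> \<alpha>" "\<alpha> \<le> 1"
  shows "((\<lambda>\<theta>. 2 * real q * (real q + 1) / pi *
      ((\<alpha> + (1 - \<alpha>) * (2 * sqrt (real q) * cos \<theta>) / (real q + 1)) ^ n * (sin \<theta>)\<^sup>2 /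
       ((real q)\<^sup>2 + 1 - 2 * real q * cos (2 * \<theta>)))) has_integral return_prob E \<alpha> x n) {0..pi}"
proof -
  let ?W = "lazy_walk E \<alpha> x n"
  let ?w = "\<lambda>\<theta>. (real q)\<^sup>2 + 1 - 2 * real q * cos (2 * \<theta>)"
  let ?C = "2 * real q * (real q + 1) / pi"
  have q: "0 < q" using assms by simp
  have supp: "finite (set_pmf ?W)" "set_pmf ?W \<subseteq> V"
    using lazy_walk_support[OF assms(2,3)] by auto
  have conn: "connected_graph V E"
    using assms(2) by (auto simp: regular_tree_def tree_graph_def)
  have "((\<lambda>\<theta>. \<Sum>v\<in>set_pmf ?W. pmf ?W v * (?C * (spherical q (graph_dist E x v) \<theta> / ?w \<theta>))) has_integral
      (\<Sum>v\<in>set_pmf ?W. pmf ?W v * (if graph_dist E x v = 0 then 1 else 0))) {0..pi}"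
    using assms(1) supp(1) by (intro has_integral_sum has_integral_mult_right spherical_orthogonality)
  also have "(\<Sum>v\<in>set_pmf ?W. pmf ?W v * (if graph_dist E x v = 0 then 1 else 0)) =
      (\<Sum>v\<in>set_pmf ?W. if v = x then pmf ?W v else 0)"
    using graph_dist_eq_0_iff[OF conn assms(3)] supp(2) by (intro sum.cong) auto
  also have "\<dots> = return_prob E \<alpha> x n"
    using supp(1) by (simp add: return_prob_def set_pmf_iff)
  also have "(\<lambda>\<theta>. \<Sum>v\<in>set_pmf ?W. pmf ?W v * (?C * (spherical q (graph_dist E x v) \<theta> / ?w \<theta>))) =
      (\<lambda>\<theta>. ?C * ((\<alpha> + (1 - \<alpha>) * (2 * sqrt (real q) * cos \<theta>) / (real q + 1)) ^ n * (sin \<theta>)\<^sup>2 / ?w \<theta>))"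
  proof
    fix \<theta>
    have "(\<Sum>v\<in>set_pmf ?W. pmf ?W v * spherical q (graph_dist E x v) \<theta>) =
        measure_pmf.expectation ?W (\<lambda>v. spherical q (graph_dist E x v) \<theta>)"
      using supp(1) by (subst integral_measure_pmf[of "set_pmf ?W"]) auto
    also have "\<dots> = (\<alpha> + (1 - \<alpha>) * (2 * sqrt (real q) * cos \<theta>) / (real q + 1)) ^ n * spherical q 0 \<theta>"
      using assms q spherical_root spherical_step
      by (intro expectation_lazy_walk_eigenfunction) auto
    finally have sum: "(\<Sum>v\<in>set_pmf ?W. pmf ?W v * spherical q (graph_dist E x v) \<theta>) =
        (\<alpha> + (1 - \<alpha>) * (2 * sqrt (real q) * cos \<theta>) / (real q + 1)) ^ n * (sin \<theta>)\<^sup>2"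
      by (simp only: spherical_0)
    have "(\<Sum>v\<in>set_pmf ?W. pmf ?W v * (?C * (spherical q (graph_dist E x v) \<theta> / ?w \<theta>))) =
        ?C * ((\<Sum>v\<in>set_pmf ?W. pmf ?W v * spherical q (graph_dist E x v) \<theta>) / ?w \<theta>)"
      unfolding sum_divide_distrib sum_distrib_left by (intro sum.cong) auto
    then show "(\<Sum>v\<in>set_pmf ?W. pmf ?W v * (?C * (spherical q (graph_dist E x v) \<theta> / ?w \<theta>))) =
        ?C * ((\<alpha> + (1 - \<alpha>) * (2 * sqrt (real q) * cos \<theta>) / (real q + 1)) ^ n * (sin \<theta>)\<^sup>2 / ?w \<theta>)"
      unfolding sum .
  qed
  finally show ?thesis .
qed

section \<open>Laplace asymptotics\<close>

lemma pos_not_nonpos_Int: "x > 0 \<Longrightarrow> x \<notin> \<int>\<^sub>\<le>\<^sub>0" for x :: real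
  by (auto dest: nonpos_Ints_nonpos)

text \<open>Log-convexity at the midpoint of \<open>x\<close> and \<open>x + 1\<close>, combined
  with the functional equation.\<close>

lemma Gamma_add_half_le:
  fixes x :: real
  assumes "x > 0"
  shows "Gamma (x + 1 / 2) \<le> sqrt x * Gamma x"
proof -
  have "ln (Gamma (x + 1 / 2)) \<le> ln (Gamma x) / 2 + ln (Gamma (x + 1)) / 2"
    using convex_onD[OF log_convex_Gamma_real, of "1/2" x "x + 1"] assms by (simp add: field_simps)
  also have "Gamma (x + 1) = x * Gamma x"
    using assms by (intro Gamma_plus1) (auto dest: nonpos_Ints_nonpos)
  also have "ln (Gamma x) / 2 + ln (x * Gamma x) / 2 = ln (sqrt x * Gamma x)"
    using assms Gamma_real_pos[OF assms] by (simp add: ln_mult ln_sqrt field_simps)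
  finally show ?thesis
    using assms Gamma_real_pos[of x] Gamma_real_pos[of "x + 1 / 2"] by (subst (asm) ln_le_cancel_iff) auto
qed

lemma has_integral_powr_times_power:
  fixes a :: real
  assumes "a > 0" "n > 0"
  shows "((\<lambda>u. u powr (a - 1) * (1 - u) ^ n) has_integral Beta a (real n + 1)) {0..1}"
proof (rule has_integral_eq)
  show "((\<lambda>u. u powr (a - 1) * (1 - u) powr (real n + 1 - 1)) has_integral Beta a (real n + 1)) {0..1}"
    using assms by (intro has_integral_Beta_real) auto
  \<comment> \<open>At \<open>u = 1\<close> both powers are 0 because \<open>n > 0\<close>; for
    exponent 0 they would differ, as \<open>0 powr 0 = 0\<close> but
    \<open>0 ^ 0 = 1\<close>.\<close>
  show "u powr (a - 1) * (1 - u) powr (real n + 1 - 1) = u powr (a - 1) * (1 - u) ^ n" if "u \<in> {0..1}" for u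
    using that assms by (cases "u = 1") (auto simp: powr_realpow)
qed

text \<open>The functional equation leaves the quotient \<open>Gamma x / Gamma (x + 1 / 2)\<close>;
  the half-step inequality at \<open>x - 1 / 2\<close> bounds it above, and at \<open>x\<close>
  below.\<close>

lemma Beta_three_halves_bounds:
  fixes x :: real
  assumes "x \<ge> 1"
  shows "Beta (3 / 2) x \<le> sqrt pi / 2 / ((x + 1 / 2) * sqrt (x - 1 / 2))"
    and "sqrt pi / 2 / ((x + 1 / 2) * sqrt x) \<le> Beta (3 / 2) x"
proof -
  have G32: "Gamma (3 / 2) = sqrt pi / 2"
    using Gamma_plus1[of "1 / 2 :: real"] pos_not_nonpos_Int[of "1 / 2"] Gamma_one_half_real by (auto dest: nonpos_Ints_nonpos)
  have Gx: "Gamma (x + 3 / 2) = (x + 1 / 2) * Gamma (x + 1 / 2)"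
    using Gamma_plus1[of "x + 1 / 2"] pos_not_nonpos_Int[of "x + 1 / 2"] assms by (simp add: add.commute)
  have pos: "Gamma x > 0" "Gamma (x + 1 / 2) > 0" "Gamma (x - 1 / 2) > 0"
    using assms by (auto intro!: Gamma_real_pos)
  have Beta: "Beta (3 / 2) x = sqrt pi / 2 / (x + 1 / 2) * (Gamma x / Gamma (x + 1 / 2))"
    unfolding Beta_def add.commute[of "3 / 2" x] Gx G32 by simp
  have split: "sqrt pi / 2 / ((x + 1 / 2) * sqrt y) = sqrt pi / 2 / (x + 1 / 2) * (1 / sqrt y)" for y
    by (simp only: divide_divide_eq_left times_divide_eq_right mult_1_right)
  have "Gamma (x + 1 / 2) = (x - 1 / 2) * Gamma (x - 1 / 2)"
    using Gamma_plus1[of "x - 1 / 2"] pos_not_nonpos_Int[of "x - 1 / 2"] assms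
    by (simp add: add.commute)
  moreover have "Gamma x \<le> sqrt (x - 1 / 2) * Gamma (x - 1 / 2)"
    using Gamma_add_half_le[of "x - 1 / 2"] assms by simp
  ultimately have "Gamma x / Gamma (x + 1 / 2) \<le>
      sqrt (x - 1 / 2) * Gamma (x - 1 / 2) / ((x - 1 / 2) * Gamma (x - 1 / 2))"
    using pos(2) by (metis divide_right_mono less_imp_le)
  also have "\<dots> = sqrt (x - 1 / 2) / (x - 1 / 2)"
    using pos(3) by simp
  also have "\<dots> = 1 / sqrt (x - 1 / 2)"
    using assms sqrt_divide_self_eq[of "x - 1 / 2"] by (simp only: inverse_eq_divide)
  finally show "Beta (3 / 2) x \<le> sqrt pi / 2 / ((x + 1 / 2) * sqrt (x - 1 / 2))"
    unfolding Beta split using assms by (intro mult_left_mono) auto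
  have "1 / sqrt x \<le> Gamma x / Gamma (x + 1 / 2)"
    using Gamma_add_half_le[of x] assms pos by (simp add: field_simps)
  then show "sqrt pi / 2 / ((x + 1 / 2) * sqrt x) \<le> Beta (3 / 2) x"
    unfolding Beta split using assms by (intro mult_left_mono) auto
qed

text \<open>Both bounds have the same leading term, and a value between them deviates from it by at
  most the sum of their deviations.\<close>

lemma Beta_three_halves_asymp:
  "(\<lambda>n. Beta (3 / 2) (real n + 1) - sqrt pi / 2 * real n powr (- 3 / 2)) \<in> O(\<lambda>n. real n powr (- 2))"
proof -
  let ?u = "\<lambda>n. sqrt pi / 2 / ((real n + 3 / 2) * sqrt (real n + 1 / 2)) - sqrt pi / 2 * real n powr (- 3 / 2)"
  let ?l = "\<lambda>n. sqrt pi / 2 / ((real n + 3 / 2) * sqrt (real n + 1)) - sqrt pi / 2 * real n powr (- 3 / 2)"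
  have "(\<lambda>n. Beta (3 / 2) (real n + 1) - sqrt pi / 2 * real n powr (- 3 / 2)) \<in> O(\<lambda>n. \<bar>?u n\<bar> + \<bar>?l n\<bar>)"
  proof (rule bigoI[of _ 1], rule always_eventually, rule allI)
    fix n :: nat
    show "norm (Beta (3 / 2) (real n + 1) - sqrt pi / 2 * real n powr (- 3 / 2)) \<le> 1 * norm (\<bar>?u n\<bar> + \<bar>?l n\<bar>)"
      using Beta_three_halves_bounds[of "real n + 1"] by (simp add: add.assoc) (simp add: add.commute)
  qed
  also have "(\<lambda>n. \<bar>?u n\<bar> + \<bar>?l n\<bar>) \<in> O(\<lambda>n. real n powr (- 2))"
  proof (rule sum_in_bigo)
    have "?u \<in> O(\<lambda>n. real n powr (- 2))" "?l \<in> O(\<lambda>n. real n powr (- 2))"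
      by real_asymp+
    then show "(\<lambda>n. \<bar>?u n\<bar>) \<in> O(\<lambda>n. real n powr (- 2))" "(\<lambda>n. \<bar>?l n\<bar>) \<in> O(\<lambda>n. real n powr (- 2))"
      by (simp_all only: landau_o.big.abs_in_iff)
  qed
  finally show ?thesis .
qed

lemma Beta_five_halves_bigo: "(\<lambda>n. Beta (5 / 2) (real n + 1)) \<in> O(\<lambda>n. real n powr (- 2))"
proof -
  have eq: "Beta (5 / 2) (real n + 1) = 3 / 2 / (real n + 5 / 2) * Beta (3 / 2) (real n + 1)" for n
    using Beta_plus1_left[of "3 / 2 :: real" "real n + 1"] pos_not_nonpos_Int[of "3 / 2"]
    by (simp add: field_simps)
  have "(\<lambda>n. Beta (3 / 2) (real n + 1)) \<in> O(\<lambda>n. real n powr (- 3 / 2))"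
  proof -
    have "(\<lambda>n. real n powr (- 2)) \<in> O(\<lambda>n. real n powr (- 3 / 2))"
      by real_asymp
    from landau_o.big_trans[OF Beta_three_halves_asymp this]
    have "(\<lambda>n. (Beta (3 / 2) (real n + 1) - sqrt pi / 2 * real n powr (- 3 / 2)) +
        sqrt pi / 2 * real n powr (- 3 / 2)) \<in> O(\<lambda>n. real n powr (- 3 / 2))"
      by (rule sum_in_bigo) simp
    then show ?thesis by simp
  qed
  \<comment> \<open>The quotient has order \<open>1 / n\<close>; the weaker exponent
    \<open>- 1 / 2\<close> already makes the total \<open>- 2\<close>.\<close>
  moreover have "(\<lambda>n. 3 / 2 / (real n + 5 / 2)) \<in> O(\<lambda>n. real n powr (- 1 / 2))"
    by real_asymp
  ultimately have "(\<lambda>n. 3 / 2 / (real n + 5 / 2) * Beta (3 / 2) (real n + 1)) \<in>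
      O(\<lambda>n. real n powr (- 1 / 2) * real n powr (- 3 / 2))"
    by (intro landau_o.big.mult)
  then show ?thesis
    by (simp add: eq flip: powr_add)
qed


section \<open>Watson's lemma at a square-root endpoint\<close>

text \<open>Beta integrals end at 1, the substituted integral at \<open>B\<close>. The interval
  between them has length at most 1, and \<open>bound\<close> applies on it.\<close>

lemma integral_Icc_diff_bound:
  fixes f :: "real \<Rightarrow> real"
  assumes "continuous_on {0..2} f" "0 < B" "B < 2"
    and bound: "\<And>u. 0 \<le> u \<Longrightarrow> u \<le> 2 \<Longrightarrow> \<bar>1 - u\<bar> \<le> \<bar>1 - B\<bar> \<Longrightarrow> \<bar>f u\<bar> \<le> r"
  shows "\<bar>integral {0..B} f - integral {0..1} f\<bar> \<le> r"
proof -
  have int: "f integrable_on {a..b}" if "0 \<le> a" "b \<le> 2" for a b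
    using that by (intro integrable_continuous_interval continuous_on_subset[OF assms(1)]) auto
  have "\<bar>f B\<bar> \<le> r"
    using assms by (intro bound) auto
  then have "0 \<le> r" by linarith
  have small: "\<bar>integral {a..b} f\<bar> \<le> r"
    if "0 \<le> a" "a \<le> b" "b \<le> 2" "b - a \<le> 1" "\<And>u. u \<in> {a..b} \<Longrightarrow> \<bar>1 - u\<bar> \<le> \<bar>1 - B\<bar>" for a b
  proof -
    have "norm (integral {a..b} f) \<le> r * (b - a)"
      using that by (intro integral_bound continuous_on_subset[OF assms(1)]) (auto intro!: bound)
    also have "\<dots> \<le> r * 1"
      using that \<open>0 \<le> r\<close> by (intro mult_left_mono) auto
    finally show ?thesis by simp
  qed
  show ?thesis
  proof (cases "B \<le> 1")
    case True
    then show ?thesis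
      using Henstock_Kurzweil_Integration.integral_combine[of 0 B 1 f] small[of B 1] int[of 0 1] assms by auto
  next
    case False
    then show ?thesis
      using Henstock_Kurzweil_Integration.integral_combine[of 0 1 B f] small[of 1 B] int[of 0 B] assms by auto
  qed
qed

lemma power_bigo_inverse_square:
  fixes r :: real
  assumes "0 \<le> r" "r < 1"
  shows "(\<lambda>n. r ^ n) \<in> O(\<lambda>n. real n powr (- 2))"
proof (cases "r = 0")
  case True
  have "eventually (\<lambda>n. norm (r ^ n) \<le> 1 * norm (real n powr (- 2))) at_top"
    using eventually_gt_at_top[of 0] by eventually_elim (simp add: True zero_power)
  then show ?thesis by (rule bigoI)
next
  case False
  then have "0 < r" using assms by simp
  then show ?thesis using assms(2) by real_asymp
qed

text \<open>Freezing \<open>g\<close> at 0 gives a Beta integral with first parameter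
  \<open>3 / 2\<close>. The Lipschitz error gains a factor \<open>u\<close>, hence parameter
  \<open>5 / 2\<close>, and moving the upper limit from \<open>B\<close> to 1 costs an exponentially
  small term.\<close>

lemma watson_sqrt:
  fixes g :: "real \<Rightarrow> real"
  assumes B: "0 < B" "B < 2" and cont: "continuous_on {0..B} g"
    and lip: "\<And>u. u \<in> {0..B} \<Longrightarrow> \<bar>g u - g 0\<bar> \<le> M * u"
  shows "(\<lambda>n. integral {0..B} (\<lambda>u. sqrt u * (1 - u) ^ n * g u) - g 0 * (sqrt pi / 2) * real n powr (- 3 / 2))
    \<in> O(\<lambda>n. real n powr (- 2))"
proof -
  define f1 where "f1 n u = sqrt u * (1 - u) ^ n" for n and u :: real
  \<comment> \<open>The absolute value matters for \<open>B > 1\<close>, where \<open>1 - u\<close>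
    can be negative; on \<open>{0..1}\<close> this is a Beta integrand.\<close>
  define f2 where "f2 n u = u * sqrt u * \<bar>1 - u\<bar> ^ n" for n and u :: real
  define r where "r = \<bar>1 - B\<bar>"
  have r: "0 \<le> r" "r < 1"
    using B by (auto simp: r_def)
  have cont1: "continuous_on S (f1 n)" and cont2: "continuous_on S (f2 n)" for n S
    unfolding f1_def f2_def by (intro continuous_intros)+
  have M: "0 \<le> M"
    using lip[of B] B by (auto simp: zero_le_mult_iff dest: order_trans[OF abs_ge_zero])
  have sqrt_le: "sqrt u \<le> 2" if "u \<le> 2" for u
    using that by (intro real_le_lsqrt) auto
  \<comment> \<open>The constant 4 comes from \<open>u \<le> 2\<close> and
    \<open>sqrt u \<le> 2\<close>.\<close>
  have f1_le: "\<bar>f1 n u\<bar> \<le> 4 * r ^ n" and f2_le: "\<bar>f2 n u\<bar> \<le> 4 * r ^ n"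
    if "0 \<le> u" "u \<le> 2" "\<bar>1 - u\<bar> \<le> \<bar>1 - B\<bar>" for n u
  proof -
    have p: "\<bar>1 - u\<bar> ^ n \<le> r ^ n"
      using that by (auto simp: r_def intro: power_mono)
    have "sqrt u \<le> 2"
      using sqrt_le that by simp
    then have "sqrt u * \<bar>1 - u\<bar> ^ n \<le> 4 * r ^ n" "u * sqrt u * \<bar>1 - u\<bar> ^ n \<le> (2 * 2) * r ^ n"
      using that p r by (intro mult_mono; simp)+
    then show "\<bar>f1 n u\<bar> \<le> 4 * r ^ n" "\<bar>f2 n u\<bar> \<le> 4 * r ^ n"
      using that by (auto simp: f1_def f2_def abs_mult power_abs)
  qed
  have I1: "integral {0..1} (f1 n) = Beta (3 / 2) (real n + 1)" if "n > 0" for n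
  proof (rule integral_unique, rule has_integral_eq)
    show "((\<lambda>u. u powr (3 / 2 - 1) * (1 - u) ^ n) has_integral Beta (3 / 2) (real n + 1)) {0..1}"
      using that by (intro has_integral_powr_times_power) auto
  qed (auto simp: f1_def powr_half_sqrt)
  have I2: "integral {0..1} (f2 n) = Beta (5 / 2) (real n + 1)" if "n > 0" for n
  proof (rule integral_unique, rule has_integral_eq)
    show "((\<lambda>u. u powr (5 / 2 - 1) * (1 - u) ^ n) has_integral Beta (5 / 2) (real n + 1)) {0..1}"
      using that by (intro has_integral_powr_times_power) auto
    show "u powr (5 / 2 - 1) * (1 - u) ^ n = f2 n u" if "u \<in> {0..1}" for u
      using that powr_add[of u 1 "1 / 2"] by (auto simp: f2_def powr_half_sqrt)
  qed
  \<comment> \<open>The term with \<open>4 * M\<close> moves the limit in the integral of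
    \<open>f2\<close>, the one with \<open>4 * \<bar>g 0\<bar>\<close> in that of
    \<open>f1\<close>.\<close>
  have main: "\<bar>integral {0..B} (\<lambda>u. f1 n u * g u) - g 0 * Beta (3 / 2) (real n + 1)\<bar>
      \<le> M * Beta (5 / 2) (real n + 1) + (4 * M + 4 * \<bar>g 0\<bar>) * r ^ n" if "n > 0" for n
  proof -
    have int: "(\<lambda>u. f1 n u * g u) integrable_on {0..B}" "(\<lambda>u. f1 n u * g 0) integrable_on {0..B}"
      by (intro integrable_continuous_interval continuous_intros cont cont1)+
    have "integral {0..B} (\<lambda>u. f1 n u * g u) - g 0 * integral {0..B} (f1 n) =
        integral {0..B} (\<lambda>u. f1 n u * g u - f1 n u * g 0)"
      using int by (subst Henstock_Kurzweil_Integration.integral_diff) (auto simp: mult.commute)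
    moreover have "norm (integral {0..B} (\<lambda>u. f1 n u * g u - f1 n u * g 0)) \<le> integral {0..B} (\<lambda>u. M * f2 n u)"
    proof (rule integral_norm_bound_integral)
      fix u assume u: "u \<in> {0..B}"
      have "norm (f1 n u * g u - f1 n u * g 0) = sqrt u * \<bar>1 - u\<bar> ^ n * \<bar>g u - g 0\<bar>"
        using u by (simp add: f1_def abs_mult power_abs flip: right_diff_distrib)
      also have "\<dots> \<le> sqrt u * \<bar>1 - u\<bar> ^ n * (M * u)"
        using lip u by (intro mult_left_mono) auto
      finally show "norm (f1 n u * g u - f1 n u * g 0) \<le> M * f2 n u"
        by (simp add: f2_def mult_ac)
    qed (intro integrable_continuous_interval continuous_intros cont cont1 cont2)+
    moreover have "integral {0..B} (\<lambda>u. M * f2 n u) \<le> M * (Beta (5 / 2) (real n + 1) + 4 * r ^ n)"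
      using integral_Icc_diff_bound[of "f2 n" B "4 * r ^ n", OF cont2 B f2_le] I2[OF that] M
      by (auto intro!: mult_left_mono)
    moreover have "\<bar>g 0 * integral {0..B} (f1 n) - g 0 * Beta (3 / 2) (real n + 1)\<bar> \<le> \<bar>g 0\<bar> * (4 * r ^ n)"
      using integral_Icc_diff_bound[of "f1 n" B "4 * r ^ n", OF cont1 B f1_le] I1[OF that]
      by (auto simp: abs_mult intro!: mult_left_mono simp flip: right_diff_distrib)
    ultimately show ?thesis
      by (simp add: algebra_simps)
  qed
  have "(\<lambda>n. integral {0..B} (\<lambda>u. f1 n u * g u) - g 0 * Beta (3 / 2) (real n + 1)) \<in>
      O(\<lambda>n. M * Beta (5 / 2) (real n + 1) + (4 * M + 4 * \<bar>g 0\<bar>) * r ^ n)"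
  proof (rule bigoI[of _ 1])
    show "eventually (\<lambda>n. norm (integral {0..B} (\<lambda>u. f1 n u * g u) - g 0 * Beta (3 / 2) (real n + 1)) \<le>
        1 * norm (M * Beta (5 / 2) (real n + 1) + (4 * M + 4 * \<bar>g 0\<bar>) * r ^ n)) at_top"
      using eventually_gt_at_top[of 0]
      by eventually_elim (use main in \<open>force intro: order_trans[OF _ abs_ge_self]\<close>)
  qed
  also have "(\<lambda>n. M * Beta (5 / 2) (real n + 1) + (4 * M + 4 * \<bar>g 0\<bar>) * r ^ n) \<in> O(\<lambda>n. real n powr (- 2))"
    using Beta_five_halves_bigo power_bigo_inverse_square[OF r]
    by (intro sum_in_bigo landau_o.big.mult_in_1) (auto intro!: landau_o.big.cmult_in_iff')
  finally have "(\<lambda>n. integral {0..B} (\<lambda>u. f1 n u * g u) - g 0 * Beta (3 / 2) (real n + 1)) \<in>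
      O(\<lambda>n. real n powr (- 2))" .
  moreover have "(\<lambda>n. g 0 * (Beta (3 / 2) (real n + 1) - sqrt pi / 2 * real n powr (- 3 / 2))) \<in>
      O(\<lambda>n. real n powr (- 2))"
  proof (cases "g 0 = 0")
    case False
    then show ?thesis
      using Beta_three_halves_asymp by (subst landau_o.big.cmult_in_iff)
  qed simp
  ultimately have "(\<lambda>n. (integral {0..B} (\<lambda>u. f1 n u * g u) - g 0 * Beta (3 / 2) (real n + 1)) +
      g 0 * (Beta (3 / 2) (real n + 1) - sqrt pi / 2 * real n powr (- 3 / 2))) \<in> O(\<lambda>n. real n powr (- 2))"
    by (rule sum_in_bigo)
  then show ?thesis
    by (simp add: f1_def algebra_simps)
qed

text \<open>With \<open>u = b (1 - cos \<theta>)\<close> the endpoint \<open>\<theta> = 0\<close>, where the base of the power is largest,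
  becomes \<open>u = 0\<close>, and \<open>b sin \<theta> d\<theta> = du\<close>.\<close>

lemma tree_integral_asymp:
  fixes b c :: real
  assumes b: "0 < b" "b < 1" and c: "1 < c"
  shows "(\<lambda>n. integral {0..pi} (\<lambda>\<theta>. (1 - b * (1 - cos \<theta>)) ^ n * (sin \<theta>)\<^sup>2 / (c\<^sup>2 + 1 - 2 * c * cos (2 * \<theta>)))
      - sqrt pi / (sqrt 2 * (b * sqrt b) * (c - 1)\<^sup>2) * real n powr (- 3 / 2))
    \<in> O(\<lambda>n. real n powr (- 2))"
proof -
  \<comment> \<open>One factor \<open>sin \<theta>\<close> is used up by the substitution; the other
    is \<open>sqrt (u / b) * sqrt (2 - u / b)\<close>. Pulling out \<open>sqrt u\<close> leaves
    \<open>g\<close>, with \<open>cos (2 * \<theta>) = 2 * (1 - u / b)\<^sup>2 - 1\<close> in the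
    denominator.\<close>
  define g where "g u = sqrt (2 - u / b) / (b * sqrt b * (c\<^sup>2 + 1 - 2 * c * (2 * (1 - u / b)\<^sup>2 - 1)))" for u
  define d where "d u = c\<^sup>2 + 1 - 2 * c * (2 * (1 - u / b)\<^sup>2 - 1)" for u
  have d_ge: "(c - 1)\<^sup>2 \<le> d u" if "u \<in> {0..2 * b}" for u
  proof -
    have "\<bar>1 - u / b\<bar> \<le> 1"
      using that b by (auto simp: abs_le_iff field_simps)
    then have "(1 - u / b)\<^sup>2 \<le> 1"
      by (simp add: abs_square_le_1)
    then have le: "c * (1 - u / b)\<^sup>2 \<le> c * 1"
      using c by (intro mult_left_mono) auto
    have "d u = (c - 1)\<^sup>2 + 4 * (c * 1 - c * (1 - u / b)\<^sup>2)"
      unfolding d_def power2_diff[of c] by (simp add: right_diff_distrib)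
    then show ?thesis
      using le by simp
  qed
  have c1: "0 < (c - 1)\<^sup>2"
    using c by simp
  have d_pos: "0 < d u" if "u \<in> {0..2 * b}" for u
    using d_ge[OF that] c1 by linarith
  have g_eq: "g u = sqrt (2 - u / b) / (b * sqrt b * d u)" for u
    by (simp add: g_def d_def)
  have cont_g: "continuous_on {0..2 * b} g"
    unfolding g_eq d_def using b d_pos by (intro continuous_intros) (force simp: d_def)+
  have d0: "d 0 = (c - 1)\<^sup>2"
    by (simp add: d_def power2_eq_square algebra_simps)
  have g0: "g 0 = sqrt 2 / (b * sqrt b * (c - 1)\<^sup>2)"
    by (simp add: g_eq d0)
  \<comment> \<open>The two summands are the Lipschitz constants from the numerator and the
    denominator of \<open>g\<close>, with \<open>d\<close> bounded below by
    \<open>d 0 = (c - 1)\<^sup>2\<close>.\<close>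
  define M where "M = (1 / (b * (c - 1)\<^sup>2) + sqrt 2 * (8 * c / b) / ((c - 1)\<^sup>2 * (c - 1)\<^sup>2)) / (b * sqrt b)"
  have lip: "\<bar>g u - g 0\<bar> \<le> M * u" if u: "u \<in> {0..2 * b}" for u
  proof -
    define x where "x = u / b"
    have x: "0 \<le> x" "x \<le> 2"
      using u b by (auto simp: x_def field_simps)
    have d_diff: "d u - d 0 = 4 * c * (2 * x - x\<^sup>2)"
      unfolding d_def by (simp add: x_def[symmetric] power2_eq_square algebra_simps)
    have "0 \<le> 2 * x - x\<^sup>2" "2 * x - x\<^sup>2 \<le> 2 * x"
      using x by (auto simp: power2_eq_square mult_right_mono)
    then have d_diff_le: "\<bar>d u - d 0\<bar> \<le> 8 * c * x"
      unfolding d_diff using c by (auto simp: abs_mult)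
    \<comment> \<open>Only increments from 0 are compared, so the infinite slope of the root at
      \<open>x = 2\<close> does no harm.\<close>
    have sqrt_diff: "\<bar>sqrt (2 - x) - sqrt 2\<bar> \<le> x"
    proof -
      have "(sqrt 2 - sqrt (2 - x)) * (sqrt 2 + sqrt (2 - x)) = x"
        using x by (simp add: algebra_simps)
      moreover have "sqrt (2 - x) \<le> sqrt 2" "1 \<le> sqrt 2 + sqrt (2 - x)"
        using x by (auto intro: add_increasing2)
      ultimately show ?thesis
        using mult_left_mono[of 1 "sqrt 2 + sqrt (2 - x)" "sqrt 2 - sqrt (2 - x)"] by simp
    qed
    have pos: "0 < d u" "0 < d 0" "d 0 \<le> d u"
      using d_pos[OF u] d_ge[OF u] c1 by (simp_all only: d0)
    have "sqrt (2 - x) / d u - sqrt 2 / d 0 = (sqrt (2 - x) - sqrt 2) / d u - sqrt 2 * (d u - d 0) / (d 0 * d u)"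
      using pos by (simp add: field_simps)
    also have "\<bar>\<dots>\<bar> \<le> \<bar>(sqrt (2 - x) - sqrt 2) / d u\<bar> + \<bar>sqrt 2 * (d u - d 0) / (d 0 * d u)\<bar>"
      by (rule abs_triangle_ineq4)
    also have "\<bar>(sqrt (2 - x) - sqrt 2) / d u\<bar> \<le> x / d 0"
      unfolding abs_divide using pos sqrt_diff x by (intro frac_le) auto
    also have "\<bar>sqrt 2 * (d u - d 0) / (d 0 * d u)\<bar> \<le> sqrt 2 * (8 * c * x) / (d 0 * d 0)"
      unfolding abs_divide abs_mult using pos d_diff_le x c by (intro frac_le mult_mono) auto
    finally have "\<bar>sqrt (2 - x) / d u - sqrt 2 / d 0\<bar> \<le> x / d 0 + sqrt 2 * (8 * c * x) / (d 0 * d 0)"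
      by simp
    then have "\<bar>sqrt (2 - x) / d u - sqrt 2 / d 0\<bar> / (b * sqrt b) \<le>
        (x / d 0 + sqrt 2 * (8 * c * x) / (d 0 * d 0)) / (b * sqrt b)"
      using b by (intro divide_right_mono) auto
    moreover have "g u - g 0 = (sqrt (2 - x) / d u - sqrt 2 / d 0) / (b * sqrt b)"
      by (simp add: g_eq x_def diff_divide_distrib mult.commute)
    moreover have "(x / d 0 + sqrt 2 * (8 * c * x) / (d 0 * d 0)) / (b * sqrt b) = M * u"
      by (simp add: M_def d0 x_def add_divide_distrib distrib_left mult_ac)
    ultimately show ?thesis
      using b by (simp add: abs_divide abs_mult)
  qed
  have subst: "integral {0..pi} (\<lambda>\<theta>. (1 - b * (1 - cos \<theta>)) ^ n * (sin \<theta>)\<^sup>2 / (c\<^sup>2 + 1 - 2 * c * cos (2 * \<theta>))) =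
      integral {0..2 * b} (\<lambda>u. sqrt u * (1 - u) ^ n * g u)" for n
  proof (rule integral_unique, rule has_integral_eq)
    let ?f = "\<lambda>u. sqrt u * (1 - u) ^ n * g u"
    show "((\<lambda>\<theta>. (b * sin \<theta>) *\<^sub>R ?f (b * (1 - cos \<theta>))) has_integral integral {0..2 * b} ?f) {0..pi}"
    proof -
      have "((\<lambda>\<theta>. (b * sin \<theta>) *\<^sub>R ?f (b * (1 - cos \<theta>))) has_integral
          integral {b * (1 - cos 0)..b * (1 - cos pi)} ?f) {0..pi}"
      \<comment> \<open>Here \<open>c\<close> and \<open>d\<close> are variables of the substitution
        rule, not the constant and the function of this proof.\<close>
      proof (rule has_integral_substitution[where c = 0 and d = "2 * b"])
        have "1 - cos \<theta> \<le> 2" for \<theta> :: real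
          using cos_ge_minus_one[of \<theta>] by linarith
        then show "(\<lambda>\<theta>. b * (1 - cos \<theta>)) ` {0..pi} \<subseteq> {0..2 * b}"
          using b by (auto simp: mult.commute[of b])
      qed (use b in \<open>auto intro!: continuous_intros cont_g derivative_eq_intros\<close>)
      then show ?thesis by (simp add: mult.commute)
    qed
    fix \<theta> :: real assume \<theta>: "\<theta> \<in> {0..pi}"
    have s: "0 \<le> sin \<theta>"
      using \<theta> by (intro sin_ge_zero) auto
    have "sqrt (1 - cos \<theta>) * sqrt (1 + cos \<theta>) = sin \<theta>"
      using s by (simp flip: real_sqrt_mult add: algebra_simps sin_squared_eq[symmetric])
         (simp add: power2_eq_square[symmetric] sin_squared_eq[symmetric])
    moreover have "b * (1 - cos \<theta>) / b = 1 - cos \<theta>"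
      using b by simp
    ultimately show "(b * sin \<theta>) *\<^sub>R ?f (b * (1 - cos \<theta>)) =
        (1 - b * (1 - cos \<theta>)) ^ n * (sin \<theta>)\<^sup>2 / (c\<^sup>2 + 1 - 2 * c * cos (2 * \<theta>))"
      using b unfolding g_def by (simp add: cos_double_cos real_sqrt_mult power2_eq_square)
  qed
  have const: "sqrt pi / (sqrt 2 * (b * sqrt b) * (c - 1)\<^sup>2) = g 0 * (sqrt pi / 2)"
  proof -
    have "1 / sqrt 2 = sqrt 2 / (2 :: real)"
      by (simp add: field_simps)
    moreover have "sqrt pi / (sqrt 2 * (b * sqrt b) * (c - 1)\<^sup>2) =
        1 / sqrt 2 * (sqrt pi / (b * sqrt b * (c - 1)\<^sup>2))"
      by (simp add: mult.assoc)
    ultimately show ?thesis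
      unfolding g0 by (simp only: times_divide_times_eq mult.commute)
  qed
  show ?thesis
    unfolding subst const
  proof (rule watson_sqrt[OF _ _ cont_g])
    show "\<bar>g u - g 0\<bar> \<le> M * u" if "u \<in> {0..2 * b}" for u
      using lip[OF that] .
  qed (use b in auto)
qed

section \<open>Assembly and matching of constants\<close>

theorem theoremB2:
  fixes q :: nat and \<alpha> \<rho> :: real
    and V :: "'v set" and E :: "'v set set" and x\<^sub>0 :: 'v
    and \<gamma> :: "real fps"
  assumes "q \<ge> 2"
    and "0 < \<alpha>" and "\<alpha> < 1"
    and "regular_tree (q + 1) V E" and "x\<^sub>0 \<in> V"
    and "\<gamma> = return_gf E \<alpha> x\<^sub>0"
    and "\<rho> = (real q + 1) / (\<alpha> * (real q + 1) + (1 - \<alpha>) * (2 * sqrt (real q)))"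
  shows "(\<lambda>n. fps_nth \<gamma> n -
            1 / sqrt (4 * pi)
            * (\<alpha> / (1 - \<alpha>) * (real q + 1) + 2 * sqrt (real q)) powr (3 / 2)
            * ((real q + 1) * real q powr (1 / 4) / (real q - 1)\<^sup>2)
            * \<rho> powr (- real n) * real n powr (- 3 / 2))
         \<in> O(\<lambda>n. \<rho> powr (- real n) * real n powr (- 2))"
proof -
  define s where "s = sqrt (real q)"
  \<comment> \<open>\<open>(1 - \<alpha>) * K\<close> is the denominator of \<rho>, and
    \<open>b\<close> is chosen so that \<rho> times the eigenvalue of a step is
    \<open>1 - b * (1 - cos \<theta>)\<close>. Laziness gives \<open>b < 1\<close>, which keeps the
    upper limit \<open>2 * b\<close> below 2.\<close>
  define K where "K = \<alpha> / (1 - \<alpha>) * (real q + 1) + 2 * s"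
  define b where "b = 2 * s / K"
  define C where "C = 2 * real q * (real q + 1) / pi"
  define I where "I n = integral {0..pi} (\<lambda>\<theta>. (1 - b * (1 - cos \<theta>)) ^ n * (sin \<theta>)\<^sup>2 /
    ((real q)\<^sup>2 + 1 - 2 * real q * cos (2 * \<theta>)))" for n
  have s: "0 < s" "real q = s * s"
    using assms(1) by (auto simp: s_def)
  have "0 < \<alpha> / (1 - \<alpha>) * (real q + 1)"
    using assms by simp
  then have K: "0 < K" "2 * s < K"
    using s(1) unfolding K_def by linarith+
  have b: "0 < b" "b < 1"
    using K s(1) by (auto simp: b_def)
  have rho_K: "\<rho> = (real q + 1) / ((1 - \<alpha>) * K)"
  proof -
    have "(1 - \<alpha>) * K = \<alpha> * (real q + 1) + (1 - \<alpha>) * (2 * sqrt (real q))"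
      using assms(3) unfolding K_def s_def by (simp add: distrib_left)
    then show ?thesis
      by (simp only: assms(7))
  qed
  have rho: "0 < \<rho>"
    unfolding rho_K using K assms(3) by simp
  have base: "\<alpha> + (1 - \<alpha>) * (2 * sqrt (real q) * cos \<theta>) / (real q + 1) = (1 / \<rho>) * (1 - b * (1 - cos \<theta>))" for \<theta>
  proof -
    have "(1 / \<rho>) * (1 - b * (1 - cos \<theta>)) = (1 - \<alpha>) * (K * (1 - b * (1 - cos \<theta>))) / (real q + 1)"
      unfolding rho_K by simp
    also have "K * (1 - b * (1 - cos \<theta>)) = \<alpha> / (1 - \<alpha>) * (real q + 1) + 2 * s * cos \<theta>"
    proof -
      have "K * b = 2 * s"
        using K by (simp add: b_def)
      then have "K * (1 - b * (1 - cos \<theta>)) = K - 2 * s * (1 - cos \<theta>)"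
        by (metis mult.assoc mult.right_neutral right_diff_distrib)
      then show ?thesis
        by (simp add: K_def algebra_simps)
    qed
    also have "(1 - \<alpha>) * (\<alpha> / (1 - \<alpha>) * (real q + 1) + 2 * s * cos \<theta>) =
        \<alpha> * (real q + 1) + (1 - \<alpha>) * (2 * s * cos \<theta>)"
      using assms(3) by (simp add: distrib_left)
    finally show ?thesis
      by (simp add: add_divide_distrib s_def)
  qed
  have rho_pow: "(1 / \<rho>) ^ n = \<rho> powr (- real n)" for n
    using rho by (simp add: powr_minus powr_realpow power_one_over inverse_eq_divide)
  have coeff: "fps_nth \<gamma> n = C * \<rho> powr (- real n) * I n" for n
  proof -
    have "fps_nth \<gamma> n = integral {0..pi} (\<lambda>\<theta>. C * \<rho> powr (- real n) * ((1 - b * (1 - cos \<theta>)) ^ n * (sin \<theta>)\<^sup>2 /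
        ((real q)\<^sup>2 + 1 - 2 * real q * cos (2 * \<theta>))))"
      using return_prob_integral[OF assms(1), of V E x\<^sub>0 \<alpha> n, THEN integral_unique] assms(2-5)
      unfolding base power_mult_distrib rho_pow assms(6) return_gf_def C_def[symmetric]
      by (simp add: mult.assoc)
    then show ?thesis
      unfolding I_def Henstock_Kurzweil_Integration.integral_mult_right .
  qed
  have const: "C * (sqrt pi / (sqrt 2 * (b * sqrt b) * (real q - 1)\<^sup>2)) =
      1 / sqrt (4 * pi) * K powr (3 / 2) * ((real q + 1) * real q powr (1 / 4) / (real q - 1)\<^sup>2)"
  proof -
    have K_powr: "K powr (3 / 2) = K * sqrt K"
      using K powr_add[of K 1 "1 / 2"] by (simp add: powr_half_sqrt)
    have q_powr: "real q powr (1 / 4) = sqrt s"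
      using s(1) powr_powr[of "real q" "1 / 2" "1 / 2"] by (simp add: s_def powr_half_sqrt)
    have sqrt_b: "sqrt b = sqrt 2 * sqrt s / sqrt K"
      by (simp add: b_def real_sqrt_mult real_sqrt_divide)
    \<comment> \<open>With square roots of \<open>pi\<close>, \<open>s\<close> and \<open>K\<close>
      as letters, \<open>r\<close> being the fourth root of \<open>q\<close>, the claim becomes a
      rational identity.\<close>
    define p where "p = sqrt pi"
    have p: "pi = p * p" "0 < p"
      by (auto simp: p_def)
    define r where "r = sqrt s"
    have r: "s = r * r" "0 < r"
      using s by (auto simp: r_def)
    define k where "k = sqrt K"
    have "sqrt 2 * (b * sqrt b) = 4 * (r * r) * r / (K * k)"
    proof -
      have "sqrt 2 * (b * sqrt b) = (sqrt 2 * sqrt 2) * (2 * s * r / (K * k))"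
        unfolding sqrt_b r_def[symmetric] k_def[symmetric] unfolding b_def
        by (simp only: divide_divide_eq_left times_divide_times_eq times_divide_eq_left times_divide_eq_right mult_ac)
      then show ?thesis
        by (simp add: r(1))
    qed
    moreover have "sqrt (4 * pi) = 2 * p"
      by (simp add: real_sqrt_mult p_def)
    moreover have "C = 2 * ((r * r) * (r * r)) * (real q + 1) / (p * p)"
      unfolding C_def p(1)[symmetric] by (simp only: s(2) r(1))
    \<comment> \<open>\<open>A\<close>, \<open>L\<close> and \<open>Q\<close> stand for
      \<open>q + 1\<close>, \<open>K * k\<close> and \<open>(q - 1)\<^sup>2\<close>.\<close>
    moreover have "2 * ((r * r) * (r * r)) * A / (p * p) * (p / (4 * (r * r) * r / L * Q)) =
        1 / (2 * p) * L * (A * r / Q)" for A L Q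
      using p(2) r(2) by (simp add: divide_simps)
    ultimately show ?thesis
      unfolding K_powr q_powr by (simp only: p_def[symmetric] r_def[symmetric] k_def[symmetric])
  qed
  have "(\<lambda>n. I n - sqrt pi / (sqrt 2 * (b * sqrt b) * (real q - 1)\<^sup>2) * real n powr (- 3 / 2))
      \<in> O(\<lambda>n. real n powr (- 2))"
    unfolding I_def using assms(1) by (intro tree_integral_asymp b) auto
  \<comment> \<open>Multiplying by \<open>C * \<rho> powr (- n)\<close> carries the exponential
    factor into the error term, where \<open>C\<close> is absorbed.\<close>
  then have "(\<lambda>n. (C * \<rho> powr (- real n)) *
      (I n - sqrt pi / (sqrt 2 * (b * sqrt b) * (real q - 1)\<^sup>2) * real n powr (- 3 / 2)))
      \<in> O(\<lambda>n. \<rho> powr (- real n) * real n powr (- 2))"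
    by (intro landau_o.big.mult) auto
  also have "(\<lambda>n. (C * \<rho> powr (- real n)) *
      (I n - sqrt pi / (sqrt 2 * (b * sqrt b) * (real q - 1)\<^sup>2) * real n powr (- 3 / 2))) =
    (\<lambda>n. fps_nth \<gamma> n - C * (sqrt pi / (sqrt 2 * (b * sqrt b) * (real q - 1)\<^sup>2)) *
      \<rho> powr (- real n) * real n powr (- 3 / 2))"
    unfolding coeff right_diff_distrib by (simp only: mult_ac)
  finally show ?thesis
    unfolding const K_def s_def .
qed

end
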